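(* Let $N\in\mathbb{N}$, $\mu\ge 0$, $\kappa>0$, and let $(\rho_i,\rho_i u_i)_{i=1,\dots,N}$, with $\rho_i>0$, be a differentiable-in-time solution, on some time interval, of the semidiscrete one-dimensional Navier-Stokes-Korteweg scheme with periodic boundary conditions given in the context. Then the scheme conserves the total mass $\frac1N\sum_{i=1}^N \rho_i$ and the total momentum $\frac1N\sum_{i=1}^N \rho_i u_i$; that is, on this time interval, $$\frac{d}{dt}\,\frac1N\sum_{i=1}^N \rho_i = 0,\qquad \frac{d}{dt}\,\frac1N\sum_{i=1}^N \rho_i u_i = 0 .$$
   Context: Grid and operators: $h=1/N$. Grid functions $\phi=(\phi_i)$ are periodic: $\phi_{i+N}=\phi_i$ for all $i\in\mathbb{Z}$. Define $$\nabla^c_x\phi_i=\frac{\phi_{i+1}-\phi_{i-1}}{2h},\quad \nabla^+_x\phi_i=\frac{\phi_{i+1}-\phi_i}{h},\quad \nabla^-_x\phi_i=\frac{\phi_i-\phi_{i-1}}{h},\quad \Delta_h\phi_i=\frac{\phi_{i+1}-2\phi_i+\phi_{i-1}}{h^2}.$$ Data: $p$ is a continuously differentiable, strictly monotone pressure function on $(0,\infty)$ such that the first order part of the system is strictly hyperbolic (i.e. $p'>0$); $\mu\ge0$ is the constant viscosity and $\kappa>0$ the constant capillarity coefficient. Scheme (the unknowns are the functions of time $\rho_i>0$ and $\rho_i u_i$, $i=1,\dots,N$): $$-\frac{d}{dt}\rho_i=\nabla^c_x(\rho_i u_i)-\lambda h\,\Delta_h\rho_i,$$ $$-\frac{d}{dt}(\rho_i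 u_i)=\nabla^c_x(\rho_i u_i^2)+\nabla^c_x p(\rho_i)-\lambda h\,\Delta_h(\rho_i u_i)-\mu\,\Delta_h u_i-\kappa\,\nabla^-_x\left[\frac{\rho_{i+1}\Delta_h\rho_i+\rho_i\Delta_h\rho_{i+1}}{2}-\frac12(\nabla^+_x\rho_i)^2\right],$$ where at each time $\lambda=\frac12\max_{i=1,\dots,N}\{|u_i|+\sqrt{p'(\rho_i)}\}$ (independent of $i$). *)

theory Defs
  imports "HOL-Analysis.Analysis"
begin

(* Grid functions are maps int => real; h is the mesh width. *)

definition grid_periodic :: "nat \<Rightarrow> (int \<Rightarrow> real) \<Rightarrow> bool" where
  "grid_periodic N \<phi> \<longleftrightarrow> (\<forall>i. \<phi> (i + int N) = \<phi> i)"

definition diff_central :: "real \<Rightarrow> (int \<Rightarrow> real) \<Rightarrow> int \<Rightarrow> real" where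
  "diff_central h \<phi> i = (\<phi> (i + 1) - \<phi> (i - 1)) / (2 * h)"

definition diff_forward :: "real \<Rightarrow> (int \<Rightarrow> real) \<Rightarrow> int \<Rightarrow> real" where
  "diff_forward h \<phi> i = (\<phi> (i + 1) - \<phi> i) / h"

definition diff_backward :: "real \<Rightarrow> (int \<Rightarrow> real) \<Rightarrow> int \<Rightarrow> real" where
  "diff_backward h \<phi> i = (\<phi> i - \<phi> (i - 1)) / h"

definition discrete_laplace :: "real \<Rightarrow> (int \<Rightarrow> real) \<Rightarrow> int \<Rightarrow> real" where
  "discrete_laplace h \<phi> i = (\<phi> (i + 1) - 2 * \<phi> i + \<phi> (i - 1)) / h\<^sup>2"

definition pressure_function :: "(real \<Rightarrow> real) \<Rightarrow> bool" where
  "pressure_function p \<longleftrightarrow>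
     p differentiable_on {0<..} \<and> continuous_on {0<..} (deriv p) \<and>
     strict_mono_on {0<..} p \<and> (\<forall>r>0. deriv p r > 0)"

definition dissipation_coeff :: "nat \<Rightarrow> (real \<Rightarrow> real) \<Rightarrow> (int \<Rightarrow> real) \<Rightarrow> (int \<Rightarrow> real) \<Rightarrow> real" where
  "dissipation_coeff N p \<rho> u =
     1 / 2 * Max ((\<lambda>i. \<bar>u i\<bar> + sqrt (deriv p (\<rho> i))) ` {1..int N})"

definition korteweg_stress :: "real \<Rightarrow> (int \<Rightarrow> real) \<Rightarrow> int \<Rightarrow> real" where
  "korteweg_stress h \<rho> i =
     (\<rho> (i + 1) * discrete_laplace h \<rho> i + \<rho> i * discrete_laplace h \<rho> (i + 1)) / 2
     - 1 / 2 * (diff_forward h \<rho> i)\<^sup>2"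

(* The two right-hand sides below equal minus the time derivatives of density and momentum. *)

definition mass_rhs ::
  "nat \<Rightarrow> (real \<Rightarrow> real) \<Rightarrow> (int \<Rightarrow> real) \<Rightarrow> (int \<Rightarrow> real) \<Rightarrow> int \<Rightarrow> real" where
  "mass_rhs N p \<rho> u i =
     (let h = 1 / real N; lam = dissipation_coeff N p \<rho> u in
        diff_central h (\<lambda>j. \<rho> j * u j) i - lam * h * discrete_laplace h \<rho> i)"

definition momentum_rhs ::
  "nat \<Rightarrow> (real \<Rightarrow> real) \<Rightarrow> real \<Rightarrow> real \<Rightarrow> (int \<Rightarrow> real) \<Rightarrow> (int \<Rightarrow> real) \<Rightarrow> int \<Rightarrow> real" where
  "momentum_rhs N p \<mu> \<kappa> \<rho> u i =
     (let h = 1 / real N; lam = dissipation_coeff N p \<rho> u in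
        diff_central h (\<lambda>j. \<rho> j * (u j)\<^sup>2) i + diff_central h (\<lambda>j. p (\<rho> j)) i
        - lam * h * discrete_laplace h (\<lambda>j. \<rho> j * u j) i
        - \<mu> * discrete_laplace h u i
        - \<kappa> * diff_backward h (korteweg_stress h \<rho>) i)"

(* Only the density and the momentum are required to be differentiable in time;
   derivatives are one-sided at endpoints belonging to I. *)

definition NSK_scheme_solution ::
  "nat \<Rightarrow> (real \<Rightarrow> real) \<Rightarrow> real \<Rightarrow> real \<Rightarrow> real set
     \<Rightarrow> (real \<Rightarrow> int \<Rightarrow> real) \<Rightarrow> (real \<Rightarrow> int \<Rightarrow> real) \<Rightarrow> bool" where
  "NSK_scheme_solution N p \<mu> \<kappa> I \<rho> u \<longleftrightarrow>
     (\<forall>t\<in>I. grid_periodic N (\<rho> t) \<and> grid_periodic N (u t) \<and>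
       (\<forall>i\<in>{1..int N}.
          \<rho> t i > 0 \<and>
          ((\<lambda>s. \<rho> s i) has_real_derivative - mass_rhs N p (\<rho> t) (u t) i) (at t within I) \<and>
          ((\<lambda>s. \<rho> s i * u s i) has_real_derivative
              - momentum_rhs N p \<mu> \<kappa> (\<rho> t) (u t) i) (at t within I)))"

end

theory Submission
  imports Defs
begin

text \<open>The scheme is in conservation form. At a fixed time, the viscosity, the capillarity and
  the dissipation coefficient are independent of the grid index, so they factor out of a sum over
  one period. What remains are sums of central differences, backward differences and Laplacians of
  periodic grid functions, all zero by shift invariance (\<open>sum_diff_central\<close>,
  \<open>sum_diff_backward\<close>, \<open>sum_discrete_laplace\<close>). Hence
  \<open>sum_mass_rhs\<close> and \<open>sum_momentum_rhs\<close>, and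
  \<open>grid_average_conserved\<close> passes from them to the time derivatives.\<close>

text \<open>Every spatial term of the scheme is a difference of shifts of one periodic grid function,
  and the sum of a periodic grid function over a period is invariant under shifts.\<close>

lemma grid_periodicD: "grid_periodic N \<phi> \<Longrightarrow> \<phi> (i + int N) = \<phi> i"
  by (simp add: grid_periodic_def)

lemma grid_periodic_shift:
  assumes "grid_periodic N \<phi>"
  shows "grid_periodic N (\<lambda>i. \<phi> (i + k))"
proof -
  have "\<phi> (i + int N + k) = \<phi> (i + k)" for i
    using grid_periodicD[OF assms, of "i + k"] by (simp add: ac_simps)
  then show ?thesis
    by (simp add: grid_periodic_def)
qed

lemma sum_forward_telescope:
  fixes \<phi> :: "int \<Rightarrow> real"
  shows "(\<Sum>i=1..int n. \<phi> (i + 1) - \<phi> i) = \<phi> (int n + 1) - \<phi> 1"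
proof (induction n)
  case (Suc n)
  \<comment> \<open>Splitting off the top index leaves the sum of the induction hypothesis plus one
    term.\<close>
  have "{1..int (Suc n)} = insert (int n + 1) {1..int n}"
    by auto
  then show ?case
    using Suc by (simp add: ac_simps)
qed simp

text \<open>The two sums differ by the telescoped boundary term
  \<open>\<phi> (int N + 1) - \<phi> 1\<close>, which periodicity kills.\<close>

lemma sum_grid_shift_forward:
  assumes "grid_periodic N \<phi>"
  shows "(\<Sum>i=1..int N. \<phi> (i + 1)) = (\<Sum>i=1..int N. \<phi> i)"
  using sum_forward_telescope[of \<phi> N] grid_periodicD[OF assms, of 1]
  by (simp add: sum_subtractf add.commute)

lemma sum_grid_shift_backward:
  assumes "grid_periodic N \<phi>"
  shows "(\<Sum>i=1..int N. \<phi> (i - 1)) = (\<Sum>i=1..int N. \<phi> i)"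
  using sum_grid_shift_forward[OF grid_periodic_shift[OF assms, of "- 1"]] by simp

lemma sum_diff_central:
  assumes "grid_periodic N \<phi>"
  shows "(\<Sum>i=1..int N. diff_central h \<phi> i) = 0"
  by (simp add: diff_central_def sum_subtractf sum_grid_shift_forward[OF assms]
      sum_grid_shift_backward[OF assms] flip: sum_divide_distrib)

lemma sum_diff_backward:
  assumes "grid_periodic N \<phi>"
  shows "(\<Sum>i=1..int N. diff_backward h \<phi> i) = 0"
  by (simp add: diff_backward_def sum_subtractf
      sum_grid_shift_backward[OF assms] flip: sum_divide_distrib)

text \<open>After undoing the shifts, the stencil weights 1, -2, 1 add up to zero.\<close>

lemma sum_discrete_laplace:
  assumes "grid_periodic N \<phi>"
  shows "(\<Sum>i=1..int N. discrete_laplace h \<phi> i) = 0"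
  by (simp add: discrete_laplace_def sum_subtractf sum.distrib sum_grid_shift_forward[OF assms]
      sum_grid_shift_backward[OF assms] flip: sum_divide_distrib sum_distrib_left)

text \<open>Makes the capillarity term a backward difference of a periodic function, however
  nonlinear the stress is in \<open>\<rho>\<close>.\<close>

lemma grid_periodic_korteweg_stress:
  assumes "grid_periodic N \<rho>"
  shows "grid_periodic N (korteweg_stress h \<rho>)"
proof -
  have shift: "\<rho> (i + int N + k) = \<rho> (i + k)" for i k
    using grid_periodic_shift[OF assms, of k] by (rule grid_periodicD)
  have "korteweg_stress h \<rho> (i + int N) = korteweg_stress h \<rho> i" for i
    \<comment> \<open>The stencil runs from -1, through the Laplacian at \<open>i\<close>, to 2,
      through the Laplacian at \<open>i + 1\<close>.\<close>
    using shift[of i 0] shift[of i 1] shift[of i 2] shift[of i "- 1"]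
    by (simp add: korteweg_stress_def discrete_laplace_def diff_forward_def add.assoc)
  then show ?thesis
    by (simp add: grid_periodic_def)
qed

lemma sum_mass_rhs:
  assumes "grid_periodic N \<rho>" and "grid_periodic N u"
  shows "(\<Sum>i=1..int N. mass_rhs N p \<rho> u i) = 0"
proof -
  have "grid_periodic N (\<lambda>i. \<rho> i * u i)"
    using assms by (simp add: grid_periodic_def)
  then show ?thesis
    by (simp add: mass_rhs_def Let_def sum_subtractf sum_diff_central
        sum_discrete_laplace[OF assms(1)] flip: sum_distrib_left sum_divide_distrib)
qed

lemma sum_momentum_rhs:
  assumes "grid_periodic N \<rho>" and "grid_periodic N u"
  shows "(\<Sum>i=1..int N. momentum_rhs N p \<mu> \<kappa> \<rho> u i) = 0"
proof -
  have "grid_periodic N (\<lambda>i. \<rho> i * u i)" "grid_periodic N (\<lambda>i. \<rho> i * (u i)\<^sup>2)"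
    "grid_periodic N (\<lambda>i. p (\<rho> i))"
    using assms by (simp_all add: grid_periodic_def)
  note zero = this[THEN sum_diff_central] this(1)[THEN sum_discrete_laplace]
    sum_discrete_laplace[OF assms(2)]
    sum_diff_backward[OF grid_periodic_korteweg_stress[OF assms(1)]]
  show ?thesis
    by (simp add: momentum_rhs_def Let_def sum_subtractf sum.distrib zero
        flip: sum_distrib_left sum_divide_distrib)
qed

text \<open>Differentiation commutes with the finite sum; this serves both mass and momentum, with
  \<open>c\<close> as the factor \<open>1 / real N\<close>.\<close>

lemma grid_average_conserved:
  assumes "\<And>i. i \<in> A \<Longrightarrow> (f i has_real_derivative - g i) (at t within S)"
    and "sum g A = 0"
  shows "((\<lambda>s. c * (\<Sum>i\<in>A. f i s)) has_real_derivative 0) (at t within S)"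
proof -
  have "((\<lambda>s. \<Sum>i\<in>A. f i s) has_real_derivative (\<Sum>i\<in>A. - g i)) (at t within S)"
    using assms(1) by (rule DERIV_sum)
  from DERIV_cmult[OF this, of c] show ?thesis
    using assms(2) by (simp add: sum_negf)
qed

theorem theorem2:
  fixes N :: nat and p :: "real \<Rightarrow> real" and \<mu> \<kappa> :: real and I :: "real set"
    and \<rho> u :: "real \<Rightarrow> int \<Rightarrow> real"
  assumes "N \<ge> 1"
    and "pressure_function p"
    and "\<mu> \<ge> 0"
    and "\<kappa> > 0"
    and "is_interval I"
    and "NSK_scheme_solution N p \<mu> \<kappa> I \<rho> u"
  shows "\<forall>t\<in>I.
      ((\<lambda>s. 1 / real N * (\<Sum>i=1..int N. \<rho> s i)) has_real_derivative 0) (at t within I) \<and>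
      ((\<lambda>s. 1 / real N * (\<Sum>i=1..int N. \<rho> s i * u s i)) has_real_derivative 0) (at t within I)"
proof
  fix t
  assume "t \<in> I"
  with assms(6) have periodic: "grid_periodic N (\<rho> t)" "grid_periodic N (u t)"
    and deriv:
      "\<And>i. i \<in> {1..int N} \<Longrightarrow>
        ((\<lambda>s. \<rho> s i) has_real_derivative - mass_rhs N p (\<rho> t) (u t) i) (at t within I)"
      "\<And>i. i \<in> {1..int N} \<Longrightarrow>
        ((\<lambda>s. \<rho> s i * u s i) has_real_derivative - momentum_rhs N p \<mu> \<kappa> (\<rho> t) (u t) i)
          (at t within I)"
    unfolding NSK_scheme_solution_def by blast+
  show "((\<lambda>s. 1 / real N * (\<Sum>i=1..int N. \<rho> s i)) has_real_derivative 0) (at t within I) \<and>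
      ((\<lambda>s. 1 / real N * (\<Sum>i=1..int N. \<rho> s i * u s i)) has_real_derivative 0) (at t within I)"
    using grid_average_conserved[OF deriv(1) sum_mass_rhs[OF periodic]]
      grid_average_conserved[OF deriv(2) sum_momentum_rhs[OF periodic]]
    by blast
qed

end
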